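(* Let $k$ be a field of any characteristic, let $n \ge 1$, and let $(\mathcal{A}, \Delta, \epsilon)$ be a unital bialgebra over $k$ that is generated by a multiplicative matrix $u = (u_{ij})_{i,j=1}^n$ and relations $R$; that is, $\mathcal{A}$ is the unital $k$-algebra generated by the $u_{ij}$ ($i,j = 1, \dots, n$) subject to the relations $R$, and $$\Delta(u_{ij}) = \sum_{l=1}^n u_{il} \otimes u_{lj}, \qquad \epsilon(u_{ij}) = \delta_{ij} \qquad (1 \le i,j \le n).$$ Then $\mathcal{A}$ is a Hopf algebra if and only if $u$ is invertible in the algebra $M_n(\mathcal{A})$ and the entries of $u^{-1}$ satisfy the opposite relations $R^{op}$. When this condition is satisfied, the antipode $S$ is given on the generators by $S(u) = u^{-1}$, i.e. $S(u_{ij}) = (u^{-1})_{ij}$ for all $i,j$.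
   Context: $M_n(\mathcal{A})$ denotes the algebra of $n \times n$ matrices over $\mathcal{A}$. "Generated by $u_{ij}$ and relations $R$" means: $R$ is a set of elements of the free unital algebra $k\langle X_{ij} : 1 \le i,j \le n\rangle$, and $\mathcal{A}$ is the quotient of this free algebra by the two-sided ideal generated by $R$, with $u_{ij}$ the image of $X_{ij}$. For $r \in R$, let $r^{op}$ be the image of $r$ under the $k$-linear anti-automorphism of the free algebra which fixes every $X_{ij}$ (it reverses the order of the letters in every word). Elements $v_{ij} \in \mathcal{A}$ satisfy the opposite relations $R^{op}$ if $r^{op}$ evaluated at $X_{ij} = v_{ij}$ is $0$ in $\mathcal{A}$ for every $r \in R$. A bialgebra is a Hopf algebra if it admits an antipode, i.e. a linear map $S : \mathcal{A} \to \mathcal{A}$ with $m(S \otimes \mathrm{id})\Delta(a) = \epsilon(a)1 = m(\mathrm{id} \otimes S)\Delta(a)$ for all $a \in \mathcal{A}$, where $m$ is the multiplication map. *)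

theory Defs
  imports "HOL-Analysis.Analysis" "HOL-Library.Poly_Mapping"
begin

section \<open>Free vector spaces\<close>

text \<open>The free vector space over \<open>'k\<close> on a type \<open>'s\<close> is \<open>'s \<Rightarrow>\<^sub>0 'k\<close>, with basis vectors
  \<open>Poly_Mapping.single s 1\<close>.\<close>

definition free_scale :: "'k::field \<Rightarrow> ('s \<Rightarrow>\<^sub>0 'k) \<Rightarrow> ('s \<Rightarrow>\<^sub>0 'k)" where
  "free_scale c p = Poly_Mapping.map ((*) c) p"

abbreviation basis :: "'s \<Rightarrow> ('s \<Rightarrow>\<^sub>0 'k::field)" where
  "basis s \<equiv> Poly_Mapping.single s 1"

text \<open>The linear extension of a map on basis vectors to a vector space with scalar
  multiplication \<open>smul\<close>.\<close>

definition lin_ext :: "('k::field \<Rightarrow> 'v::ab_group_add \<Rightarrow> 'v) \<Rightarrow> ('s \<Rightarrow> 'v) \<Rightarrow> ('s \<Rightarrow>\<^sub>0 'k) \<Rightarrow> 'v" where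
  "lin_ext smul f p = (\<Sum>s\<in>Poly_Mapping.keys p. smul (Poly_Mapping.lookup p s) (f s))"

lemma lookup_free_scale [simp]:
  "Poly_Mapping.lookup (free_scale c p) s = c * Poly_Mapping.lookup p s"
  by (simp add: free_scale_def Poly_Mapping.map.rep_eq when_def)

lemma vector_space_free_scale: "vector_space (free_scale :: 'k::field \<Rightarrow> ('s \<Rightarrow>\<^sub>0 'k) \<Rightarrow> _)"
  by unfold_locales (auto intro!: poly_mapping_eqI simp: lookup_add algebra_simps)

section \<open>Algebras, free algebras and presentations\<close>

locale k_algebra = vector_space smul
  for smul :: "'k::field \<Rightarrow> 'a::ring_1 \<Rightarrow> 'a" +
  assumes scale_mult_left: "smul c x * y = smul c (x * y)"
    and scale_mult_right: "x * smul c y = smul c (x * y)"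

text \<open>Words form a monoid under concatenation, written additively so that the convolution product of
  \<open>Poly_Mapping\<close> makes \<open>'x list \<Rightarrow>\<^sub>0 'k\<close> the free unital algebra on the letters \<open>'x\<close>.\<close>

instantiation list :: (type) monoid_add
begin

definition zero_list :: "'a list" where "zero_list = []"
definition plus_list :: "'a list \<Rightarrow> 'a list \<Rightarrow> 'a list" where "plus_list v w = v @ w"

instance by standard (simp_all add: zero_list_def plus_list_def)

end

type_synonym ('x, 'k) free_algebra = "'x list \<Rightarrow>\<^sub>0 'k"

definition eval_free ::
    "('k::field \<Rightarrow> 'a::ring_1 \<Rightarrow> 'a) \<Rightarrow> ('x \<Rightarrow> 'a) \<Rightarrow> ('x, 'k) free_algebra \<Rightarrow> 'a" where
  "eval_free smul v = lin_ext smul (\<lambda>w. prod_list (map v w))"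

text \<open>The linear anti-automorphism of the free algebra that reverses every word.\<close>

definition opp :: "('x, 'k::field) free_algebra \<Rightarrow> ('x, 'k) free_algebra" where
  "opp = lin_ext free_scale (\<lambda>w. basis (rev w))"

definition two_sided_ideal :: "'r::ring_1 set \<Rightarrow> bool" where
  "two_sided_ideal I \<longleftrightarrow>
     0 \<in> I \<and> (\<forall>x\<in>I. \<forall>y\<in>I. x + y \<in> I) \<and> (\<forall>x\<in>I. \<forall>r. r * x \<in> I \<and> x * r \<in> I)"

text \<open>The algebra is the quotient of the free algebra by the two-sided ideal generated by \<open>R\<close>, with
  \<open>g x\<close> the image of the letter \<open>x\<close>: evaluation at \<open>g\<close> is onto and its kernel is that ideal.\<close>

definition presented_by ::
    "('k::field \<Rightarrow> 'a::ring_1 \<Rightarrow> 'a) \<Rightarrow> ('x \<Rightarrow> 'a) \<Rightarrow> ('x, 'k) free_algebra set \<Rightarrow> bool" where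
  "presented_by smul g R \<longleftrightarrow>
     surj (eval_free smul g) \<and> {p. eval_free smul g p = 0} = two_sided_ideal hull R"

definition satisfies ::
    "('k::field \<Rightarrow> 'a::ring_1 \<Rightarrow> 'a) \<Rightarrow> ('x \<Rightarrow> 'a) \<Rightarrow> ('x, 'k) free_algebra set \<Rightarrow> bool" where
  "satisfies smul v R \<longleftrightarrow> (\<forall>r\<in>R. eval_free smul v r = 0)"

section \<open>Tensor powers of an algebra\<close>

text \<open>\<open>A \<otimes> A\<close> is the free vector space on \<open>A \<times> A\<close> modulo the span of the bilinearity relations; its
  elements are the classes in \<open>UNIV // tensor_rel smul\<close>. Likewise \<open>A \<otimes> A \<otimes> A\<close> is the free vector
  space on \<open>A \<times> A \<times> A\<close> modulo the trilinearity relations.\<close>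

type_synonym ('a, 'k) tensor = "('a \<times> 'a \<Rightarrow>\<^sub>0 'k) set"
type_synonym ('a, 'k) tensor3 = "('a \<times> 'a \<times> 'a \<Rightarrow>\<^sub>0 'k) set"

definition tensor_null ::
    "('k::field \<Rightarrow> 'a::ring_1 \<Rightarrow> 'a) \<Rightarrow> ('a \<times> 'a \<Rightarrow>\<^sub>0 'k) set" where
  "tensor_null smul = module.span free_scale
    ({basis (x + x', y) - basis (x, y) - basis (x', y) | x x' y. True} \<union>
     {basis (x, y + y') - basis (x, y) - basis (x, y') | x y y'. True} \<union>
     {basis (smul c x, y) - free_scale c (basis (x, y)) | c x y. True} \<union>
     {basis (x, smul c y) - free_scale c (basis (x, y)) | c x y. True})"

definition tensor_rel ::
    "('k::field \<Rightarrow> 'a::ring_1 \<Rightarrow> 'a) \<Rightarrow> (('a \<times> 'a \<Rightarrow>\<^sub>0 'k) \<times> ('a \<times> 'a \<Rightarrow>\<^sub>0 'k)) set" where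
  "tensor_rel smul = {(p, q). p - q \<in> tensor_null smul}"

definition tensor3_null ::
    "('k::field \<Rightarrow> 'a::ring_1 \<Rightarrow> 'a) \<Rightarrow> ('a \<times> 'a \<times> 'a \<Rightarrow>\<^sub>0 'k) set" where
  "tensor3_null smul = module.span free_scale
    ({basis (x + x', y, z) - basis (x, y, z) - basis (x', y, z) | x x' y z. True} \<union>
     {basis (x, y + y', z) - basis (x, y, z) - basis (x, y', z) | x y y' z. True} \<union>
     {basis (x, y, z + z') - basis (x, y, z) - basis (x, y, z') | x y z z'. True} \<union>
     {basis (smul c x, y, z) - free_scale c (basis (x, y, z)) | c x y z. True} \<union>
     {basis (x, smul c y, z) - free_scale c (basis (x, y, z)) | c x y z. True} \<union>
     {basis (x, y, smul c z) - free_scale c (basis (x, y, z)) | c x y z. True})"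

definition tensor3_rel ::
    "('k::field \<Rightarrow> 'a::ring_1 \<Rightarrow> 'a) \<Rightarrow>
      (('a \<times> 'a \<times> 'a \<Rightarrow>\<^sub>0 'k) \<times> ('a \<times> 'a \<times> 'a \<Rightarrow>\<^sub>0 'k)) set" where
  "tensor3_rel smul = {(p, q). p - q \<in> tensor3_null smul}"

abbreviation tensor_class ::
    "('k::field \<Rightarrow> 'a::ring_1 \<Rightarrow> 'a) \<Rightarrow> ('a \<times> 'a \<Rightarrow>\<^sub>0 'k) \<Rightarrow> ('a, 'k) tensor" where
  "tensor_class smul p \<equiv> tensor_rel smul `` {p}"

abbreviation tensor3_class ::
    "('k::field \<Rightarrow> 'a::ring_1 \<Rightarrow> 'a) \<Rightarrow> ('a \<times> 'a \<times> 'a \<Rightarrow>\<^sub>0 'k) \<Rightarrow> ('a, 'k) tensor3" where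
  "tensor3_class smul p \<equiv> tensor3_rel smul `` {p}"

text \<open>Operations on classes are computed on representatives.\<close>

definition tensor_add ::
    "('k::field \<Rightarrow> 'a::ring_1 \<Rightarrow> 'a) \<Rightarrow> ('a, 'k) tensor \<Rightarrow> ('a, 'k) tensor \<Rightarrow> ('a, 'k) tensor" where
  "tensor_add smul X Y = (\<Union>p\<in>X. \<Union>q\<in>Y. tensor_class smul (p + q))"

definition tensor_scale ::
    "('k::field \<Rightarrow> 'a::ring_1 \<Rightarrow> 'a) \<Rightarrow> 'k \<Rightarrow> ('a, 'k) tensor \<Rightarrow> ('a, 'k) tensor" where
  "tensor_scale smul c X = (\<Union>p\<in>X. tensor_class smul (free_scale c p))"

definition free_tensor_mult ::
    "('a::ring_1 \<times> 'a \<Rightarrow>\<^sub>0 'k::field) \<Rightarrow> ('a \<times> 'a \<Rightarrow>\<^sub>0 'k) \<Rightarrow> ('a \<times> 'a \<Rightarrow>\<^sub>0 'k)" where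
  "free_tensor_mult p q =
     lin_ext free_scale (\<lambda>(a, b). lin_ext free_scale (\<lambda>(c, d). basis (a * c, b * d)) q) p"

definition tensor_mult ::
    "('k::field \<Rightarrow> 'a::ring_1 \<Rightarrow> 'a) \<Rightarrow> ('a, 'k) tensor \<Rightarrow> ('a, 'k) tensor \<Rightarrow> ('a, 'k) tensor" where
  "tensor_mult smul X Y = (\<Union>p\<in>X. \<Union>q\<in>Y. tensor_class smul (free_tensor_mult p q))"

text \<open>The map \<open>f \<otimes> g\<close>, for linear \<open>f\<close> and \<open>g\<close>.\<close>

definition tensor_map ::
    "('k::field \<Rightarrow> 'a::ring_1 \<Rightarrow> 'a) \<Rightarrow> ('a \<Rightarrow> 'a) \<Rightarrow> ('a \<Rightarrow> 'a) \<Rightarrow> ('a, 'k) tensor \<Rightarrow> ('a, 'k) tensor" where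
  "tensor_map smul f g X =
     (\<Union>p\<in>X. tensor_class smul (lin_ext free_scale (\<lambda>(a, b). basis (f a, g b)) p))"

text \<open>The linear map on \<open>A \<otimes> A\<close> induced by a bilinear map \<open>f\<close>, which takes a single value on all
  representatives of a class.\<close>

definition tensor_lift ::
    "('k::field \<Rightarrow> 'a::ring_1 \<Rightarrow> 'a) \<Rightarrow> ('a \<Rightarrow> 'a \<Rightarrow> 'a) \<Rightarrow> ('a, 'k) tensor \<Rightarrow> 'a" where
  "tensor_lift smul f X = the_elem (lin_ext smul (\<lambda>(a, b). f a b) ` X)"

text \<open>\<open>\<Delta> \<otimes> id\<close> and \<open>id \<otimes> \<Delta>\<close> as maps \<open>A \<otimes> A \<rightarrow> A \<otimes> A \<otimes> A\<close>; \<open>d\<close> ranges over the choices of a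
  representative of each \<open>\<Delta> a\<close>.\<close>

definition comult_id ::
    "('k::field \<Rightarrow> 'a::ring_1 \<Rightarrow> 'a) \<Rightarrow> ('a \<Rightarrow> ('a, 'k) tensor) \<Rightarrow> ('a, 'k) tensor \<Rightarrow> ('a, 'k) tensor3" where
  "comult_id smul \<Delta> X = (\<Union>d\<in>{d. \<forall>a. d a \<in> \<Delta> a}. \<Union>p\<in>X. tensor3_class smul
     (lin_ext free_scale (\<lambda>(a, b). lin_ext free_scale (\<lambda>(s, t). basis (s, t, b)) (d a)) p))"

definition id_comult ::
    "('k::field \<Rightarrow> 'a::ring_1 \<Rightarrow> 'a) \<Rightarrow> ('a \<Rightarrow> ('a, 'k) tensor) \<Rightarrow> ('a, 'k) tensor \<Rightarrow> ('a, 'k) tensor3" where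
  "id_comult smul \<Delta> X = (\<Union>d\<in>{d. \<forall>a. d a \<in> \<Delta> a}. \<Union>p\<in>X. tensor3_class smul
     (lin_ext free_scale (\<lambda>(a, b). lin_ext free_scale (\<lambda>(s, t). basis (a, s, t)) (d b)) p))"

section \<open>Bialgebras and Hopf algebras\<close>

locale bialgebra = k_algebra smul
  for smul :: "'k::field \<Rightarrow> 'a::ring_1 \<Rightarrow> 'a" +
  fixes \<Delta> :: "'a \<Rightarrow> ('a, 'k) tensor" and \<epsilon> :: "'a \<Rightarrow> 'k"
  assumes comult_in: "\<Delta> a \<in> UNIV // tensor_rel smul"
    and comult_add: "\<Delta> (a + b) = tensor_add smul (\<Delta> a) (\<Delta> b)"
    and comult_scale: "\<Delta> (smul c a) = tensor_scale smul c (\<Delta> a)"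
    and comult_mult: "\<Delta> (a * b) = tensor_mult smul (\<Delta> a) (\<Delta> b)"
    and comult_one: "\<Delta> 1 = tensor_class smul (basis (1, 1))"
    and counit_linear: "Vector_Spaces.linear smul (*) \<epsilon>"
    and counit_mult: "\<epsilon> (a * b) = \<epsilon> a * \<epsilon> b"
    and counit_one: "\<epsilon> 1 = 1"
    and coassoc: "comult_id smul \<Delta> (\<Delta> a) = id_comult smul \<Delta> (\<Delta> a)"
    and counit_left: "tensor_lift smul (\<lambda>x y. smul (\<epsilon> x) y) (\<Delta> a) = a"
    and counit_right: "tensor_lift smul (\<lambda>x y. smul (\<epsilon> y) x) (\<Delta> a) = a"

definition is_antipode ::
    "('k::field \<Rightarrow> 'a::ring_1 \<Rightarrow> 'a) \<Rightarrow> ('a \<Rightarrow> ('a, 'k) tensor) \<Rightarrow> ('a \<Rightarrow> 'k) \<Rightarrow> ('a \<Rightarrow> 'a) \<Rightarrow> bool" where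
  "is_antipode smul \<Delta> \<epsilon> S \<longleftrightarrow> Vector_Spaces.linear smul smul S \<and>
     (\<forall>a. tensor_lift smul (*) (tensor_map smul S id (\<Delta> a)) = smul (\<epsilon> a) 1 \<and>
          tensor_lift smul (*) (tensor_map smul id S (\<Delta> a)) = smul (\<epsilon> a) 1)"

locale hopf_algebra = bialgebra +
  assumes antipode_exists: "\<exists>S. is_antipode smul \<Delta> \<epsilon> S"

end

theory Submission
  imports Defs
begin

text \<open>For words \<open>I\<close>, \<open>J\<close> of equal length \<open>k\<close>, let \<open>u\<^bsub>I,J\<^esub>\<close> be the product of the \<open>u\<^bsub>i,j\<^esub>\<close> along \<open>I\<close> and
  \<open>J\<close>. These elements span the algebra, and for each \<open>k\<close> they form again a multiplicative matrix, so
  an antipode \<open>S\<close> turns this matrix into its inverse. If \<open>v\<close> is the inverse of \<open>u\<close>, then the inverse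
  at length \<open>k\<close> is also given by the products of the \<open>v\<^bsub>i,j\<^esub>\<close> in reversed order, whence
  \<open>S u\<^bsub>I,J\<^esub>\<close> is the reversed product. So \<open>S\<close> reverses products of generators, and applying it to the
  relations gives the opposite relations. Conversely, the opposite relations make the reversed
  evaluation at \<open>v\<close> descend to the quotient, and the antipode axiom need only be checked on the
  \<open>u\<^bsub>I,J\<^esub>\<close>.\<close>

section \<open>Linear extensions\<close>

lemma linear_add: "Vector_Spaces.linear s1 s2 f \<Longrightarrow> f (x + y) = f x + f y"
  and linear_scale: "Vector_Spaces.linear s1 s2 f \<Longrightarrow> f (s1 c x) = s2 c (f x)"
  and linear_diff: "Vector_Spaces.linear s1 s2 f \<Longrightarrow> f (x - y) = f x - f y"
  and linear_zero: "Vector_Spaces.linear s1 s2 f \<Longrightarrow> f 0 = 0"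
  and linear_sum: "Vector_Spaces.linear s1 s2 f \<Longrightarrow> f (sum h A) = (\<Sum>a\<in>A. f (h a))"
  by (simp_all add: module_hom_iff_linear[symmetric] module_hom.add module_hom.scale
      module_hom.diff module_hom.zero module_hom.sum)

lemma (in vector_space) linearI:
  assumes "\<And>x y. f (x + y) = f x + f y" "\<And>c x. f (scale c x) = scale c (f x)"
  shows "Vector_Spaces.linear scale scale f"
  using assms
  by (auto intro!: Vector_Spaces.linear.intro module_hom.intro module_hom_axioms.intro
      vector_space_axioms module_axioms)

context vector_space
begin

text \<open>Zero coefficients contribute nothing. Cancellation may shrink the support of a sum, so
  additivity is checked over a common finite index set.\<close>

lemma lin_ext_superset:
  assumes "finite A" "Poly_Mapping.keys p \<subseteq> A"
  shows "lin_ext scale f p = (\<Sum>s\<in>A. scale (Poly_Mapping.lookup p s) (f s))"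
  unfolding lin_ext_def using assms
  by (intro sum.mono_neutral_left) (auto simp: in_keys_iff)

lemma linear_lin_ext: "Vector_Spaces.linear free_scale scale (lin_ext scale f)"
proof (intro Vector_Spaces.linear.intro module_hom.intro module_hom_axioms.intro)
  show vs: "vector_space (free_scale :: 'a \<Rightarrow> ('c \<Rightarrow>\<^sub>0 'a) \<Rightarrow> _)"
    by (rule vector_space_free_scale)
  show "module (free_scale :: 'a \<Rightarrow> ('c \<Rightarrow>\<^sub>0 'a) \<Rightarrow> _)"
    using vs by (simp add: module_iff_vector_space)
  show "vector_space scale" "module scale"
    by (fact vector_space_axioms module_axioms)+
  show "lin_ext scale f (p + q) = lin_ext scale f p + lin_ext scale f q" for p q
  proof -
    let ?A = "Poly_Mapping.keys p \<union> Poly_Mapping.keys q"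
    have "Poly_Mapping.keys (p + q) \<subseteq> ?A"
      by (rule Poly_Mapping.keys_add)
    then show ?thesis
      by (simp add: lin_ext_superset[of ?A] lookup_add scale_left_distrib sum.distrib)
  qed
  show "lin_ext scale f (free_scale c p) = scale c (lin_ext scale f p)" for c p
  proof -
    have "Poly_Mapping.keys (free_scale c p) \<subseteq> Poly_Mapping.keys p"
      by (auto simp: in_keys_iff)
    then show ?thesis
      by (simp add: lin_ext_superset[of "Poly_Mapping.keys p"] scale_sum_right)
  qed
qed

lemmas lin_ext_add = linear_add[OF linear_lin_ext]
  and lin_ext_scale = linear_scale[OF linear_lin_ext]
  and lin_ext_diff = linear_diff[OF linear_lin_ext]
  and lin_ext_sum = linear_sum[OF linear_lin_ext]

lemma lin_ext_single: "lin_ext scale f (Poly_Mapping.single s c) = scale c (f s)"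
  by (simp add: lin_ext_superset[of "{s}"])

lemma lin_ext_basis [simp]: "lin_ext scale f (basis s) = f s"
  by (simp add: lin_ext_single)

lemma linear_lin_ext_comp:
  assumes "Vector_Spaces.linear smul' scale h"
  shows "h (lin_ext smul' f p) = lin_ext scale (\<lambda>s. h (f s)) p"
  unfolding lin_ext_def by (simp add: linear_sum[OF assms] linear_scale[OF assms])

end

interpretation free: vector_space "free_scale :: 'k::field \<Rightarrow> ('s \<Rightarrow>\<^sub>0 'k) \<Rightarrow> _"
  by (rule vector_space_free_scale)

lemma poly_mapping_eq_sum_single:
  "p = (\<Sum>s\<in>Poly_Mapping.keys p. Poly_Mapping.single s (Poly_Mapping.lookup p s))"
  by (intro poly_mapping_eqI) (auto simp: lookup_sum lookup_single when_def in_keys_iff)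

section \<open>Evaluation on tensors\<close>

lemma tensor_class_iff: "q \<in> tensor_class smul p \<longleftrightarrow> p - q \<in> tensor_null smul"
  by (simp add: tensor_rel_def)

lemma equiv_tensor_rel: "equiv UNIV (tensor_rel smul)"
proof (rule equivI)
  show "refl (tensor_rel smul)"
    by (auto simp: refl_on_def tensor_rel_def tensor_null_def free.span_zero)
  show "sym (tensor_rel smul)"
    by (rule symI) (auto simp: tensor_rel_def tensor_null_def dest: free.span_neg)
  show "trans (tensor_rel smul)"
    by (rule transI) (auto simp: tensor_rel_def tensor_null_def dest: free.span_add)
qed auto

lemma self_in_tensor_class: "p \<in> tensor_class smul p"
  by (rule equiv_class_self[OF equiv_tensor_rel UNIV_I])

lemma quotient_eq_tensor_class:
  assumes "X \<in> UNIV // tensor_rel smul" "p \<in> X"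
  shows "X = tensor_class smul p"
proof -
  obtain q where "X = tensor_class smul q"
    using assms(1) by (auto elim: quotientE)
  with assms(2) show ?thesis
    using equiv_class_eq[OF equiv_tensor_rel] by auto
qed

context k_algebra
begin

lemma lin_ext_mult:
  "lin_ext smul g (p * q) = (\<Sum>s\<in>Poly_Mapping.keys p. \<Sum>t\<in>Poly_Mapping.keys q.
     smul (Poly_Mapping.lookup p s * Poly_Mapping.lookup q t) (g (s + t)))"
proof -
  have "p * q = (\<Sum>s\<in>Poly_Mapping.keys p. \<Sum>t\<in>Poly_Mapping.keys q.
     Poly_Mapping.single (s + t) (Poly_Mapping.lookup p s * Poly_Mapping.lookup q t))"
    by (subst poly_mapping_eq_sum_single[of p], subst poly_mapping_eq_sum_single[of q])
      (simp add: sum_product mult_single)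
  then show ?thesis
    by (simp add: lin_ext_sum lin_ext_single)
qed

text \<open>The coefficients lie in a field and commute, so reversal of factors on basis elements
  extends bilinearly to the convolution product.\<close>

lemma lin_ext_antimultiplicative:
  assumes "\<And>s t. g (s + t) = g t * g s"
  shows "lin_ext smul g (p * q) = lin_ext smul g q * lin_ext smul g p"
proof -
  have "lin_ext smul g q * lin_ext smul g p = (\<Sum>t\<in>Poly_Mapping.keys q. \<Sum>s\<in>Poly_Mapping.keys p.
     smul (Poly_Mapping.lookup p s * Poly_Mapping.lookup q t) (g (s + t)))"
    unfolding lin_ext_def
    by (simp add: sum_product scale_mult_left scale_mult_right assms mult.commute)
  then show ?thesis
    by (simp add: lin_ext_mult sum.swap[of _ "Poly_Mapping.keys q"])
qed

text \<open>The linearity hypotheses send each bilinearity relation to 0, hence also their span. A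
  bilinear map thus has a single value on each tensor class.\<close>

lemma lin_ext_tensor_null:
  assumes left: "\<And>y. Vector_Spaces.linear smul smul (\<lambda>x. f x y)"
    and right: "\<And>x. Vector_Spaces.linear smul smul (f x)"
    and "p \<in> tensor_null smul"
  shows "lin_ext smul (\<lambda>(a, b). f a b) p = 0"
  using assms(3) unfolding tensor_null_def
proof (induction rule: free.span_induct_alt)
  case base
  show ?case by (simp add: lin_ext_def)
next
  case (step c x y)
  have "lin_ext smul (\<lambda>(a, b). f a b) x = 0"
    using step(1)
    by (auto simp: lin_ext_diff lin_ext_scale linear_add[OF left] linear_add[OF right]
        linear_scale[OF left] linear_scale[OF right])
  with step(2) show ?case
    by (simp add: lin_ext_add lin_ext_scale)
qed

lemma lin_ext_tensor_class:
  assumes "\<And>y. Vector_Spaces.linear smul smul (\<lambda>x. f x y)"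
    and "\<And>x. Vector_Spaces.linear smul smul (f x)"
    and "q \<in> tensor_class smul p"
  shows "lin_ext smul (\<lambda>(a, b). f a b) q = lin_ext smul (\<lambda>(a, b). f a b) p"
  using lin_ext_tensor_null[OF assms(1,2), of "p - q"] assms(3)
  unfolding tensor_class_iff by (simp add: lin_ext_diff)

lemma linear_mult_left:
  "Vector_Spaces.linear smul smul g \<Longrightarrow> Vector_Spaces.linear smul smul (\<lambda>x. g x * y)"
  by (intro linearI) (simp_all add: linear_add linear_scale scale_mult_left distrib_right)

lemma linear_mult_right:
  "Vector_Spaces.linear smul smul g \<Longrightarrow> Vector_Spaces.linear smul smul (\<lambda>x. y * g x)"
  by (intro linearI) (simp_all add: linear_add linear_scale scale_mult_right distrib_left)

lemma linear_id_smul: "Vector_Spaces.linear smul smul id"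
  by (intro linearI) simp_all

text \<open>\<open>tensor_map\<close> is a union over all representatives. Evaluation takes one
  value on that union, and this alone determines \<open>the_elem\<close>.\<close>

lemma tensor_lift_map:
  assumes f: "Vector_Spaces.linear smul smul f" and g: "Vector_Spaces.linear smul smul g"
  shows "tensor_lift smul (*) (tensor_map smul f g (tensor_class smul p)) =
    lin_ext smul (\<lambda>(a, b). f a * g b) p" (is "_ = ?r")
proof -
  let ?m = "\<lambda>q. lin_ext free_scale (\<lambda>(a, b). basis (f a, g b)) q"
  let ?X = "tensor_map smul f g (tensor_class smul p)"
  have "lin_ext smul (\<lambda>(a, b). a * b) x = ?r" if x: "x \<in> ?X" for x
  proof -
    obtain q where q: "q \<in> tensor_class smul p" and xq: "x \<in> tensor_class smul (?m q)"
      using x unfolding tensor_map_def by blast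
    have "lin_ext smul (\<lambda>(a, b). a * b) x = lin_ext smul (\<lambda>(a, b). a * b) (?m q)"
      using linear_mult_left[OF linear_id_smul] linear_mult_right[OF linear_id_smul] xq
      by (intro lin_ext_tensor_class) simp_all
    also have "\<dots> = lin_ext smul (\<lambda>(a, b). f a * g b) q"
      by (simp add: linear_lin_ext_comp[OF linear_lin_ext] case_prod_unfold)
    also have "\<dots> = ?r"
      using linear_mult_left[OF f] linear_mult_right[OF g] q
      by (intro lin_ext_tensor_class) simp_all
    finally show ?thesis .
  qed
  \<comment> \<open>The union is nonempty, so its image is the singleton of the common
    value.\<close>
  moreover have "?m p \<in> ?X"
    unfolding tensor_map_def using self_in_tensor_class by blast
  ultimately have "lin_ext smul (\<lambda>(a, b). a * b) ` ?X = {?r}"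
    by (metis (no_types, lifting) empty_iff image_cong image_constant)
  then show ?thesis
    by (simp add: tensor_lift_def)
qed

end

context bialgebra
begin

lemma comult_eq_class: "p \<in> \<Delta> a \<Longrightarrow> \<Delta> a = tensor_class smul p"
  by (rule quotient_eq_tensor_class[OF comult_in])

lemma comult_class_cases:
  obtains p where "\<Delta> a = tensor_class smul p"
  using comult_in[of a] by (auto elim: quotientE)

text \<open>Since \<open>\<Delta> (a * b)\<close> is a class, it is determined by any of its members, so it does not matter
  here whether products of representatives respect the equivalence.\<close>

lemma comult_mult_class:
  assumes "\<Delta> a = tensor_class smul p" "\<Delta> b = tensor_class smul q"
  shows "\<Delta> (a * b) = tensor_class smul (free_tensor_mult p q)"
  using self_in_tensor_class assms
  by (intro comult_eq_class) (auto simp only: comult_mult tensor_mult_def intro!: UN_I)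

lemma comult_add_class:
  assumes "\<Delta> a = tensor_class smul p" "\<Delta> b = tensor_class smul q"
  shows "\<Delta> (a + b) = tensor_class smul (p + q)"
  using self_in_tensor_class assms
  by (intro comult_eq_class) (auto simp only: comult_add tensor_add_def intro!: UN_I)

lemma comult_scale_class:
  assumes "\<Delta> a = tensor_class smul p"
  shows "\<Delta> (smul c a) = tensor_class smul (free_scale c p)"
  using self_in_tensor_class assms
  by (intro comult_eq_class) (auto simp only: comult_scale tensor_scale_def intro!: UN_I)

text \<open>With \<open>S\<close> and \<open>id\<close> in either order this is one side of an
  antipode identity; linearity reduces the identity to a spanning set.\<close>

lemma linear_convolution:
  assumes "Vector_Spaces.linear smul smul f" "Vector_Spaces.linear smul smul g"
  shows "Vector_Spaces.linear smul smul (\<lambda>a. tensor_lift smul (*) (tensor_map smul f g (\<Delta> a)))"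
proof (rule linearI)
  show "tensor_lift smul (*) (tensor_map smul f g (\<Delta> (a + b))) =
      tensor_lift smul (*) (tensor_map smul f g (\<Delta> a)) +
      tensor_lift smul (*) (tensor_map smul f g (\<Delta> b))" for a b
  proof -
    obtain p q where "\<Delta> a = tensor_class smul p" "\<Delta> b = tensor_class smul q"
      by (meson comult_class_cases)
    then show ?thesis
      using comult_add_class[of a p b q] by (simp add: tensor_lift_map[OF assms] lin_ext_add)
  qed
  show "tensor_lift smul (*) (tensor_map smul f g (\<Delta> (smul c a))) =
      smul c (tensor_lift smul (*) (tensor_map smul f g (\<Delta> a)))" for c a
  proof -
    obtain p where "\<Delta> a = tensor_class smul p"
      by (rule comult_class_cases)
    then show ?thesis
      using comult_scale_class[of a p] by (simp add: tensor_lift_map[OF assms] lin_ext_scale)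
  qed
qed

lemma linear_counit_unit: "Vector_Spaces.linear smul smul (\<lambda>a. smul (\<epsilon> a) 1)"
  using counit_linear by (intro linearI) (simp_all add: linear_add linear_scale scale_left_distrib)

end

section \<open>Products of matrix entries along words\<close>

definition word_entry :: "'a::monoid_mult ^ 'n ^ 'n \<Rightarrow> 'n list \<Rightarrow> 'n list \<Rightarrow> 'a" where
  "word_entry u I J = prod_list (map2 (\<lambda>i j. u $ i $ j) I J)"

text \<open>Only the order of the factors is reversed. The index words keep theirs, so that these
  entries form a matrix over the same words as \<open>word_entry\<close>.\<close>

definition rev_word_entry :: "'a::monoid_mult ^ 'n ^ 'n \<Rightarrow> 'n list \<Rightarrow> 'n list \<Rightarrow> 'a" where
  "rev_word_entry u I J = prod_list (rev (map2 (\<lambda>i j. u $ i $ j) I J))"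

lemma word_entry_simps [simp]:
  "word_entry u [] J = 1"
  "word_entry u (i # I) (j # J) = u $ i $ j * word_entry u I J"
  by (simp_all add: word_entry_def)

lemma rev_word_entry_simps [simp]:
  "rev_word_entry u [] J = 1"
  "rev_word_entry u (i # I) (j # J) = rev_word_entry u I J * u $ i $ j"
  by (simp_all add: rev_word_entry_def)

lemma finite_words: "finite {L :: 'n::finite list. length L = k}"
  using finite_lists_length_eq[of "UNIV :: 'n set" k] by simp

lemma sum_words_Suc:
  "(\<Sum>L | length L = Suc k. f L) = (\<Sum>l\<in>UNIV. \<Sum>L | length L = k. f (l # L))"
  for f :: "'n::finite list \<Rightarrow> 'b::comm_monoid_add"
proof -
  have "{L :: 'n list. length L = Suc k} = (\<lambda>(l, L). l # L) ` (UNIV \<times> {L. length L = k})"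
    by (auto simp: length_Suc_conv image_iff)
  moreover have inj: "inj_on (\<lambda>(l, L). l # L) (UNIV \<times> {L :: 'n list. length L = k})"
    by (auto simp: inj_on_def)
  ultimately show ?thesis
    by (simp only: sum.reindex[OF inj] sum.cartesian_product) (simp add: case_prod_unfold)
qed

lemma sum_entries_eq_delta:
  assumes "v ** u = mat 1"
  shows "(\<Sum>l\<in>UNIV. v $ i $ l * u $ l $ j) = (if i = j then 1 else 0)"
  using arg_cong[OF assms, of "\<lambda>w. w $ i $ j"] by (simp add: matrix_matrix_mult_def mat_def)

text \<open>The entries for the first letters meet in the middle of the product. Summing over the
  first letter of \<open>L\<close> collapses them to a delta, and induction handles the
  rest.\<close>

lemma rev_word_entry_mult_word_entry:
  fixes u v :: "'a::ring_1 ^ 'n::finite ^ 'n"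
  assumes "v ** u = mat 1" "length I = k" "length J = k"
  shows "(\<Sum>L | length L = k. rev_word_entry v I L * word_entry u L J) = (if I = J then 1 else 0)"
  using assms(2,3)
proof (induction k arbitrary: I J)
  case 0
  then show ?case by simp
next
  case (Suc k)
  obtain i I' j J' where IJ: "I = i # I'" "J = j # J'" and len: "length I' = k" "length J' = k"
    using Suc.prems by (auto simp: length_Suc_conv)
  have "(\<Sum>L | length L = Suc k. rev_word_entry v I L * word_entry u L J) =
      (\<Sum>L | length L = k. rev_word_entry v I' L * (\<Sum>l\<in>UNIV. v $ i $ l * u $ l $ j) * word_entry u L J')"
    unfolding sum_words_Suc
    by (subst sum.swap) (simp add: IJ sum_distrib_left sum_distrib_right mult.assoc)
  then show ?case
    using Suc.IH[OF len] by (cases "i = j"; cases "I' = J'")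
      (simp_all add: sum_entries_eq_delta[OF assms(1)] IJ)
qed

text \<open>Here the entries for the first letters are outermost, so the inner sum is collapsed
  first by induction and the sum over the first letter comes last.\<close>

lemma word_entry_mult_rev_word_entry:
  fixes u v :: "'a::ring_1 ^ 'n::finite ^ 'n"
  assumes "u ** v = mat 1" "length I = k" "length J = k"
  shows "(\<Sum>L | length L = k. word_entry u I L * rev_word_entry v L J) = (if I = J then 1 else 0)"
  using assms(2,3)
proof (induction k arbitrary: I J)
  case 0
  then show ?case by simp
next
  case (Suc k)
  obtain i I' j J' where IJ: "I = i # I'" "J = j # J'" and len: "length I' = k" "length J' = k"
    using Suc.prems by (auto simp: length_Suc_conv)
  have "(\<Sum>L | length L = Suc k. word_entry u I L * rev_word_entry v L J) =
      (\<Sum>l\<in>UNIV. u $ i $ l * (\<Sum>L | length L = k. word_entry u I' L * rev_word_entry v L J') * v $ l $ j)"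
    unfolding sum_words_Suc by (simp add: IJ sum_distrib_left sum_distrib_right mult.assoc)
  then show ?case
    using Suc.IH[OF len] sum_entries_eq_delta[OF assms(1), of i j]
    by (cases "i = j"; cases "I' = J'") (simp_all add: IJ)
qed

section \<open>Bialgebras with a multiplicative matrix\<close>

locale matrix_bialgebra = bialgebra smul \<Delta> \<epsilon>
  for smul :: "'k::field \<Rightarrow> 'a::ring_1 \<Rightarrow> 'a" and \<Delta> \<epsilon> +
  fixes u :: "'a ^ 'n::finite ^ 'n"
  assumes comult_u: "\<Delta> (u $ i $ j) =
      tensor_class smul (\<Sum>l\<in>UNIV. basis (u $ i $ l, u $ l $ j))"
    and counit_u: "\<epsilon> (u $ i $ j) = (if i = j then 1 else 0)"
begin

text \<open>Multiplicativity of \<Delta> pairs each first letter \<open>l\<close> with each word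
  \<open>L\<close> of the remaining length, giving exactly the words \<open>l # L\<close>.\<close>

lemma comult_word_entry:
  assumes "length I = k" "length J = k"
  shows "\<Delta> (word_entry u I J) =
    tensor_class smul (\<Sum>L | length L = k. basis (word_entry u I L, word_entry u L J))"
  using assms
proof (induction k arbitrary: I J)
  case 0
  then show ?case by (simp add: comult_one)
next
  case (Suc k)
  obtain i I' j J' where IJ: "I = i # I'" "J = j # J'" and len: "length I' = k" "length J' = k"
    using Suc.prems by (auto simp: length_Suc_conv)
  show ?case
    using comult_mult_class[OF comult_u[of i j] Suc.IH[OF len]]
    by (simp add: IJ free_tensor_mult_def free.lin_ext_sum sum_words_Suc)
qed

lemma counit_word_entry:
  assumes "length I = length J"
  shows "\<epsilon> (word_entry u I J) = (if I = J then 1 else 0)"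
  using assms by (induction I J rule: list_induct2) (simp_all add: counit_one counit_mult counit_u)

text \<open>On words of length \<open>k\<close>, convolution becomes the matrix product of the
  entrywise images under \<open>f\<close> and \<open>g\<close>.\<close>

lemma convolution_word_entry:
  assumes "Vector_Spaces.linear smul smul f" "Vector_Spaces.linear smul smul g"
    and "length I = k" "length J = k"
  shows "tensor_lift smul (*) (tensor_map smul f g (\<Delta> (word_entry u I J))) =
    (\<Sum>L | length L = k. f (word_entry u I L) * g (word_entry u L J))"
  using assms by (simp add: comult_word_entry tensor_lift_map lin_ext_sum)

text \<open>A word in index pairs is the zip of its row and column indices, so every product of
  generators is a word entry, and these span by surjectivity.\<close>

lemma linear_eq_on_word_entries:
  assumes surj: "surj (eval_free smul (\<lambda>(i, j). u $ i $ j))"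
    and f: "Vector_Spaces.linear smul smul f" and g: "Vector_Spaces.linear smul smul g"
    and eq: "\<And>I J. length I = length J \<Longrightarrow> f (word_entry u I J) = g (word_entry u I J)"
  shows "f a = g a"
proof -
  obtain p where a: "a = eval_free smul (\<lambda>(i, j). u $ i $ j) p"
    using surj by (metis surjD)
  have "f (prod_list (map (\<lambda>(i, j). u $ i $ j) w)) = g (prod_list (map (\<lambda>(i, j). u $ i $ j) w))" for w
    using eq[of "map fst w" "map snd w"] by (simp add: word_entry_def zip_map_fst_snd)
  then show ?thesis
    unfolding a eval_free_def by (simp add: linear_lin_ext_comp f g)
qed

section \<open>Antipodes as inverse matrices\<close>

lemma antipode_inverse:
  assumes "is_antipode smul \<Delta> \<epsilon> S"
  shows "(\<chi> i j. S (u $ i $ j)) ** u = mat 1" "u ** (\<chi> i j. S (u $ i $ j)) = mat 1"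
proof -
  have S: "Vector_Spaces.linear smul smul S"
    using assms by (simp add: is_antipode_def)
  have "(\<Sum>l\<in>UNIV. S (u $ i $ l) * u $ l $ j) = (if i = j then 1 else 0)"
    and "(\<Sum>l\<in>UNIV. u $ i $ l * S (u $ l $ j)) = (if i = j then 1 else 0)" for i j
    using assms tensor_lift_map[OF S linear_id_smul, of "\<Sum>l\<in>UNIV. basis (u $ i $ l, u $ l $ j)"]
      tensor_lift_map[OF linear_id_smul S, of "\<Sum>l\<in>UNIV. basis (u $ i $ l, u $ l $ j)"]
    by (cases "i = j"; simp add: is_antipode_def lin_ext_sum counit_u flip: comult_u)+
  then show "(\<chi> i j. S (u $ i $ j)) ** u = mat 1" "u ** (\<chi> i j. S (u $ i $ j)) = mat 1"
    by (simp_all add: vec_eq_iff matrix_matrix_mult_def mat_def)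
qed

text \<open>In length \<open>k\<close> the image under \<open>S\<close> is a left inverse of the
  matrix of word entries, and the reversed products are a right inverse. Associativity makes the two
  equal.\<close>

lemma antipode_word_entry:
  assumes S: "is_antipode smul \<Delta> \<epsilon> S" and v: "u ** v = mat 1"
    and I: "length I = k" and J: "length J = k"
  shows "S (word_entry u I J) = rev_word_entry v I J"
proof -
  have lin: "Vector_Spaces.linear smul smul S"
    using S by (simp add: is_antipode_def)
  have inv: "(\<Sum>L | length L = k. S (word_entry u I L) * word_entry u L M) = (if I = M then 1 else 0)"
    if "length M = k" for M
    using S convolution_word_entry[OF lin linear_id_smul I that] counit_word_entry[of I M] I that
    by (cases "I = M") (simp_all add: is_antipode_def)
  have "S (word_entry u I J) =
      (\<Sum>L | length L = k. S (word_entry u I L) * (if L = J then 1 else 0))"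
    using J by (subst sum.remove[OF finite_words, of J]) (auto intro!: sum.neutral)
  also have "\<dots> = (\<Sum>L | length L = k. S (word_entry u I L) *
      (\<Sum>M | length M = k. word_entry u L M * rev_word_entry v M J))"
    using word_entry_mult_rev_word_entry[OF v _ J] by (intro sum.cong) auto
  also have "\<dots> = (\<Sum>M | length M = k.
      (\<Sum>L | length L = k. S (word_entry u I L) * word_entry u L M) * rev_word_entry v M J)"
    unfolding sum_distrib_left sum_distrib_right by (subst sum.swap) (simp add: mult.assoc)
  also have "\<dots> = (\<Sum>M | length M = k. (if I = M then 1 else 0) * rev_word_entry v M J)"
    using inv by (intro sum.cong) auto
  also have "\<dots> = rev_word_entry v I J"
    using I by (subst sum.remove[OF finite_words, of I]) (auto intro!: sum.neutral split: if_splits)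
  finally show ?thesis .
qed

section \<open>Reversed evaluation and the opposite relations\<close>

lemma eval_free_opp:
  "eval_free smul g (opp p) = lin_ext smul (\<lambda>w. prod_list (map g (rev w))) p"
  unfolding eval_free_def opp_def by (simp add: linear_lin_ext_comp[OF linear_lin_ext])

text \<open>Both sides are linear in \<open>p\<close> and agree on words. A relation vanishes at
  \<open>u\<close>, so its opposite vanishes at \<open>v\<close>.\<close>

lemma antipode_eval_free:
  assumes S: "is_antipode smul \<Delta> \<epsilon> S" and v: "u ** v = mat 1"
  shows "S (eval_free smul (\<lambda>(i, j). u $ i $ j) p) = eval_free smul (\<lambda>(i, j). v $ i $ j) (opp p)"
proof -
  have lin: "Vector_Spaces.linear smul smul S"
    using S by (simp add: is_antipode_def)
  have "S (prod_list (map (\<lambda>(i, j). u $ i $ j) w)) = prod_list (map (\<lambda>(i, j). v $ i $ j) (rev w))" for w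
    using antipode_word_entry[OF S v, of "map fst w" "length w" "map snd w"]
    by (simp add: word_entry_def rev_word_entry_def zip_map_fst_snd rev_map)
  then show ?thesis
    unfolding eval_free_opp eval_free_def[of smul "\<lambda>(i, j). u $ i $ j"]
    by (simp add: linear_lin_ext_comp[OF lin])
qed

text \<open>Reversed evaluation is antimultiplicative; the swap of factors exchanges left and right
  absorption, so its kernel is still two-sided.\<close>

lemma two_sided_ideal_opp_kernel:
  "two_sided_ideal {p. eval_free smul g (opp p) = 0}"
proof -
  have "lin_ext smul (\<lambda>w. prod_list (map g (rev w))) (p * q) =
      lin_ext smul (\<lambda>w. prod_list (map g (rev w))) q * lin_ext smul (\<lambda>w. prod_list (map g (rev w))) p"
    for p q
    by (rule lin_ext_antimultiplicative) (simp add: plus_list_def)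
  then show ?thesis
    unfolding two_sided_ideal_def eval_free_opp
    by (auto simp: lin_ext_add linear_zero[OF linear_lin_ext])
qed

lemma antipode_from_inverse:
  assumes pres: "presented_by smul (\<lambda>(i, j). u $ i $ j) R"
    and vu: "v ** u = mat 1" and uv: "u ** v = mat 1"
    and sat: "satisfies smul (\<lambda>(i, j). v $ i $ j) (opp ` R)"
  shows "\<exists>S. is_antipode smul \<Delta> \<epsilon> S"
proof -
  let ?u = "eval_free smul (\<lambda>(i, j). u $ i $ j)"
  let ?v = "\<lambda>p. eval_free smul (\<lambda>(i, j). v $ i $ j) (opp p)"
  have lin_u: "Vector_Spaces.linear free_scale smul ?u"
    unfolding eval_free_def by (rule linear_lin_ext)
  have lin_v: "Vector_Spaces.linear free_scale smul ?v"
    unfolding eval_free_opp by (rule linear_lin_ext)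
  have surj: "surj ?u"
    using pres by (simp add: presented_by_def)
  \<comment> \<open>The hull is the kernel of \<open>?u\<close>, so this inclusion lets
    \<open>?v\<close> factor through the quotient.\<close>
  have "two_sided_ideal hull R \<subseteq> {p. ?v p = 0}"
    using sat by (intro hull_minimal two_sided_ideal_opp_kernel) (auto simp: satisfies_def)
  then have ker: "?v p = 0" if "?u p = 0" for p
    using pres that by (auto simp: presented_by_def)
  \<comment> \<open>Any preimage serves: two of them differ by an element of the kernel of
    \<open>?u\<close>, on which \<open>?v\<close> vanishes.\<close>
  define S where "S a = ?v (SOME p. ?u p = a)" for a
  have S_eval: "S (?u p) = ?v p" for p
  proof -
    have "?u (SOME q. ?u q = ?u p) = ?u p"
      by (rule someI[of _ p]) simp
    then have "?v ((SOME q. ?u q = ?u p) - p) = 0"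
      by (intro ker) (simp add: linear_diff[OF lin_u])
    then show ?thesis
      by (simp add: S_def linear_diff[OF lin_v])
  qed
  have lin: "Vector_Spaces.linear smul smul S"
  proof (rule linearI)
    fix a b c
    obtain p q where "a = ?u p" "b = ?u q"
      using surj by (metis surjD)
    then show "S (a + b) = S a + S b" "S (smul c a) = smul c (S a)"
      by (simp_all add: S_eval linear_add[OF lin_v] linear_scale[OF lin_v]
          flip: linear_add[OF lin_u] linear_scale[OF lin_u])
  qed
  \<comment> \<open>The preimage is the single word \<open>zip I J\<close>; both entries truncate to
    the shorter index word, which covers unequal lengths.\<close>
  have S_word: "S (word_entry u I J) = rev_word_entry v I J" for I J
    using S_eval[of "basis (zip I J)"]
    unfolding eval_free_opp unfolding eval_free_def
    by (simp add: word_entry_def rev_word_entry_def rev_map)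
  \<comment> \<open>On word entries the left side is a matrix product equal to the identity, whose
    entries are the values of \<epsilon>.\<close>
  have "tensor_lift smul (*) (tensor_map smul S id (\<Delta> a)) = smul (\<epsilon> a) 1" for a
    by (rule linear_eq_on_word_entries[OF surj linear_convolution linear_counit_unit])
      (simp_all add: lin linear_id_smul convolution_word_entry S_word counit_word_entry
        rev_word_entry_mult_word_entry[OF vu])
  moreover have "tensor_lift smul (*) (tensor_map smul id S (\<Delta> a)) = smul (\<epsilon> a) 1" for a
    by (rule linear_eq_on_word_entries[OF surj linear_convolution linear_counit_unit])
      (simp_all add: lin linear_id_smul convolution_word_entry S_word counit_word_entry
        word_entry_mult_rev_word_entry[OF uv])
  ultimately show ?thesis
    using lin by (auto simp: is_antipode_def)
qed

end

section \<open>The equivalence and the values of the antipode\<close>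

lemma matrix_inv_mult:
  fixes u :: "'a::semiring_1 ^ 'n::finite ^ 'n"
  assumes "invertible u"
  shows "u ** matrix_inv u = mat 1" "matrix_inv u ** u = mat 1"
  using someI_ex[OF assms[unfolded invertible_def]] by (simp_all add: matrix_inv_def)

theorem theorem1:
  fixes smul :: "'k::field \<Rightarrow> 'a::ring_1 \<Rightarrow> 'a"
    and \<Delta> :: "'a \<Rightarrow> ('a, 'k) tensor"
    and \<epsilon> :: "'a \<Rightarrow> 'k"
    and u :: "'a ^ 'n::finite ^ 'n"
    and R :: "('n \<times> 'n, 'k) free_algebra set"
  assumes bialg: "bialgebra smul \<Delta> \<epsilon>"
    and pres: "presented_by smul (\<lambda>(i, j). u $ i $ j) R"
    and comult_u: "\<And>i j. \<Delta> (u $ i $ j) =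
      tensor_class smul (\<Sum>l\<in>UNIV. basis (u $ i $ l, u $ l $ j))"
    and counit_u: "\<And>i j. \<epsilon> (u $ i $ j) = (if i = j then 1 else 0)"
  shows "(hopf_algebra smul \<Delta> \<epsilon> \<longleftrightarrow>
           invertible u \<and> satisfies smul (\<lambda>(i, j). matrix_inv u $ i $ j) (opp ` R)) \<and>
         (invertible u \<and> satisfies smul (\<lambda>(i, j). matrix_inv u $ i $ j) (opp ` R) \<longrightarrow>
           (\<forall>S. is_antipode smul \<Delta> \<epsilon> S \<longrightarrow> (\<forall>i j. S (u $ i $ j) = matrix_inv u $ i $ j)))"
proof -
  interpret matrix_bialgebra smul \<Delta> \<epsilon> u
    using bialg comult_u counit_u by (simp add: matrix_bialgebra_def matrix_bialgebra_axioms_def)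
  let ?C = "invertible u \<and> satisfies smul (\<lambda>(i, j). matrix_inv u $ i $ j) (opp ` R)"
  have hopf: "hopf_algebra smul \<Delta> \<epsilon> \<longleftrightarrow> (\<exists>S. is_antipode smul \<Delta> \<epsilon> S)"
    using bialg by (simp add: hopf_algebra_def hopf_algebra_axioms_def)
  have inv: "invertible u" if "is_antipode smul \<Delta> \<epsilon> S" for S
    using antipode_inverse[OF that] by (auto simp: invertible_def)
  have S_u: "S (u $ i $ j) = matrix_inv u $ i $ j" if S: "is_antipode smul \<Delta> \<epsilon> S" for S i j
    \<comment> \<open>A generator is a word entry for one-letter words, where reversal changes
      nothing.\<close>
    using antipode_word_entry[OF S matrix_inv_mult(1)[OF inv[OF S]], of "[i]" 1 "[j]"] by simp
  have "?C" if S: "is_antipode smul \<Delta> \<epsilon> S" for S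
  proof -
    have "eval_free smul (\<lambda>(i, j). matrix_inv u $ i $ j) (opp r) = 0" if "r \<in> R" for r
    proof -
      have "eval_free smul (\<lambda>(i, j). u $ i $ j) r = 0"
        using pres hull_subset[of R two_sided_ideal] that by (auto simp: presented_by_def)
      moreover have "S 0 = 0"
        using S by (intro linear_zero[of smul smul]) (simp add: is_antipode_def)
      ultimately show ?thesis
        by (simp flip: antipode_eval_free[OF S matrix_inv_mult(1)[OF inv[OF S]]])
    qed
    then show ?thesis
      using inv[OF S] by (simp add: satisfies_def)
  qed
  moreover have "\<exists>S. is_antipode smul \<Delta> \<epsilon> S" if "?C"
    using antipode_from_inverse[OF pres] matrix_inv_mult that by blast
  ultimately show ?thesis
    using hopf S_u by blast
qed

end
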